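(* Let $E$ be a finite set. The following statements are equivalent for a set $L\subseteq\{\pm1\}^E$: (i) $L$ is ample; (ii) $\mathrm{Baryc}(L)$ satisfies (SCA); (iii) $\mathrm{Cocirc}(L)$ satisfies (SCA); (iv) $\mathrm{Baryc}(L^* )$ satisfies (SCA); (v) $\mathrm{Circ}(L)$ satisfies (SCA). Furthermore, if $J\subseteq\{\pm1,0\}^E$ satisfies (SCA) and $\mathrm{Min}(J)=J$, then the set $L=\,\uparrow\! J\cap\{\pm1\}^E$ is ample and $\mathrm{Cocirc}(L)=J$.
   Context: $E$ is a finite set; $\{\pm1\}^E$ and $\{\pm1,0\}^E$ are the sets of maps from $E$ to $\{-1,+1\}$ and $\{-1,0,+1\}$. For $L\subseteq\{\pm1\}^E$, $L^*:=\{\pm1\}^E-L$. Ampleness: a set $A\subseteq E$ is shattered by $L\subseteq\{\pm1\}^E$ if $\{s|_A: s\in L\}=\{\pm1\}^A$. $L$ is ample if $\#L$ equals the number of subsets $A\subseteq E$ shattered by $L$. Order: $\prec$ is the (reflexive) product order on $\{\pm1,0\}^E$ with $t_1\prec t_2$ iff $t_1(x)\in\{0,t_2(x)\}$ for all $x\in E$. For $J\subseteq\{\pm1,0\}^E$: $\uparrow\! J=\{t'\in\{\pm1,0\}^E: t\prec t'\text{ for some }t\in J\}$, and $\mathrm{Min}(J)$ is the set of minimal elements of $(J,\prec)$. $\mathrm{Baryc}(L)=\{t\in\{\pm1,0\}^E: \text{every } s\in\{\pm1\}^E\text{ with }t\prec s\text{ belongs to }L\}$; equivalently, the set of barycenters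 of those faces of the cube $[-1,+1]^E$ all of whose vertices lie in $L$. The set of cocircuits is $\mathrm{Cocirc}(L):=\mathrm{Min}(\mathrm{Baryc}(L))$ and the set of circuits is $\mathrm{Circ}(L):=\mathrm{Cocirc}(L^* )$. Signed-circuit axiom: $J\subseteq\{\pm1,0\}^E$ satisfies (SCA) if for all $t',t''\in J$ and $e\in E$ with $t'(e)t''(e)=-1$ there exists $t\in J$ with $t(e)=0$ and $t(f)\in\{0,t'(f),t''(f)\}$ for all $f\in E$. *)

theory Defs
  imports "HOL-Library.FuncSet"
begin

(* Maps with domain E are the extensional functions of FuncSet: they take the value
   undefined outside E, so equality of functions is equality of maps on E, and E may be empty. *)

definition sign_vectors :: "'a set \<Rightarrow> ('a \<Rightarrow> int) set" where
  "sign_vectors E = E \<rightarrow>\<^sub>E {-1, 1}"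

definition signed_vectors :: "'a set \<Rightarrow> ('a \<Rightarrow> int) set" where
  "signed_vectors E = E \<rightarrow>\<^sub>E {-1, 0, 1}"

definition complementary :: "'a set \<Rightarrow> ('a \<Rightarrow> int) set \<Rightarrow> ('a \<Rightarrow> int) set" where
  "complementary E L = sign_vectors E - L"

definition shattered_by :: "'a set \<Rightarrow> ('a \<Rightarrow> int) set \<Rightarrow> bool" where
  "shattered_by A L \<longleftrightarrow> (\<lambda>s. restrict s A) ` L = sign_vectors A"

definition ample :: "'a set \<Rightarrow> ('a \<Rightarrow> int) set \<Rightarrow> bool" where
  "ample E L \<longleftrightarrow> card L = card {A. A \<subseteq> E \<and> shattered_by A L}"

definition prec :: "'a set \<Rightarrow> ('a \<Rightarrow> int) \<Rightarrow> ('a \<Rightarrow> int) \<Rightarrow> bool" where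
  "prec E t1 t2 \<longleftrightarrow> (\<forall>x\<in>E. t1 x \<in> {0, t2 x})"

definition up_set :: "'a set \<Rightarrow> ('a \<Rightarrow> int) set \<Rightarrow> ('a \<Rightarrow> int) set" where
  "up_set E J = {t' \<in> signed_vectors E. \<exists>t\<in>J. prec E t t'}"

definition min_elements :: "'a set \<Rightarrow> ('a \<Rightarrow> int) set \<Rightarrow> ('a \<Rightarrow> int) set" where
  "min_elements E J = {t \<in> J. \<forall>t'\<in>J. prec E t' t \<longrightarrow> t' = t}"

definition baryc :: "'a set \<Rightarrow> ('a \<Rightarrow> int) set \<Rightarrow> ('a \<Rightarrow> int) set" where
  "baryc E L = {t \<in> signed_vectors E. \<forall>s \<in> sign_vectors E. prec E t s \<longrightarrow> s \<in> L}"

definition cocirc :: "'a set \<Rightarrow> ('a \<Rightarrow> int) set \<Rightarrow> ('a \<Rightarrow> int) set" where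
  "cocirc E L = min_elements E (baryc E L)"

definition circ :: "'a set \<Rightarrow> ('a \<Rightarrow> int) set \<Rightarrow> ('a \<Rightarrow> int) set" where
  "circ E L = cocirc E (complementary E L)"

definition signed_circuit_axiom :: "'a set \<Rightarrow> ('a \<Rightarrow> int) set \<Rightarrow> bool" where
  "signed_circuit_axiom E J \<longleftrightarrow>
     (\<forall>t'\<in>J. \<forall>t''\<in>J. \<forall>e\<in>E. t' e * t'' e = -1 \<longrightarrow>
        (\<exists>t\<in>J. t e = 0 \<and> (\<forall>f\<in>E. t f \<in> {0, t' f, t'' f})))"

end

theory Submission
  imports Defs
begin

text \<open>
  Call a set \<open>A\<close> strongly shattered by \<open>L\<close> if \<open>L\<close> contains all vertices of some face of the cube
  whose free coordinates include \<open>A\<close>. A pattern on \<open>A\<close> is missed by \<open>L\<close> exactly if a face with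
  free coordinates \<open>E - A\<close> lies in \<open>L\<^sup>*\<close>; so \<open>A\<close> is shattered by \<open>L\<close> iff \<open>E - A\<close> is not strongly
  shattered by \<open>L\<^sup>*\<close>. Splitting along one coordinate gives
  \<open>#strongly shattered \<le> #L \<le> #shattered\<close>, and if the second inequality is an equality, so is the
  first. Hence \<open>L\<close> is ample iff every shattered set is strongly shattered, a condition which is
  visibly invariant under \<open>L \<mapsto> L\<^sup>*\<close> and which passes to the intersection of \<open>L\<close> with a face.
  Given two elements of \<open>Baryc L\<close> to be eliminated at \<open>e\<close>, restrict to the face on which they do
  not contradict each other: their common zeros together with \<open>e\<close> are shattered there, and strong
  shattering is the elimination property. Conversely, elimination applied to one element of a
  shattered set after another builds a face. Passing to minimal elements or to up-sets preserves
  the axiom.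
\<close>

text \<open>The zeros of \<open>t\<close> are the free coordinates of a face of \<open>L\<close>.
  Further zeros outside \<open>A\<close> are allowed, so the notion passes to subsets of
  \<open>A\<close>.\<close>

definition strongly_shattered_by :: "'a set \<Rightarrow> 'a set \<Rightarrow> ('a \<Rightarrow> int) set \<Rightarrow> bool" where
  "strongly_shattered_by E A L \<longleftrightarrow> (\<exists>t\<in>baryc E L. \<forall>x\<in>A. t x = 0)"

text \<open>With \<open>e\<close> outside \<open>E\<close>, the union of the slices for 1 and -1 is
  the projection of \<open>L\<close> along \<open>e\<close>; their intersection records the edges in
  direction \<open>e\<close> with both ends in \<open>L\<close>.\<close>

definition slice :: "'a set \<Rightarrow> 'a \<Rightarrow> int \<Rightarrow> ('a \<Rightarrow> int) set \<Rightarrow> ('a \<Rightarrow> int) set" where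
  "slice E e c L = {s \<in> sign_vectors E. s(e := c) \<in> L}"

section \<open>Elementary facts on sign vectors, shattering and the order\<close>

lemma finite_sign_vectors: "finite E \<Longrightarrow> finite (sign_vectors E)"
  by (simp add: sign_vectors_def finite_PiE)

lemma sign_vectors_iff:
  "s \<in> sign_vectors E \<longleftrightarrow> (\<forall>x\<in>E. s x = 1 \<or> s x = -1) \<and> (\<forall>x. x \<notin> E \<longrightarrow> s x = undefined)"
  by (auto simp: sign_vectors_def PiE_iff extensional_def)

lemma signed_vectors_iff:
  "t \<in> signed_vectors E \<longleftrightarrow>
     (\<forall>x\<in>E. t x = 0 \<or> t x = 1 \<or> t x = -1) \<and> (\<forall>x. x \<notin> E \<longrightarrow> t x = undefined)"
  by (auto simp: signed_vectors_def PiE_iff extensional_def)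

lemma shattered_by_iff:
  assumes "L \<subseteq> sign_vectors E" "A \<subseteq> E"
  shows "shattered_by A L \<longleftrightarrow> (\<forall>p\<in>sign_vectors E. \<exists>s\<in>L. \<forall>x\<in>A. s x = p x)"
proof
  assume sh: "shattered_by A L"
  show "\<forall>p\<in>sign_vectors E. \<exists>s\<in>L. \<forall>x\<in>A. s x = p x"
  proof
    fix p assume "p \<in> sign_vectors E"
    then have "restrict p A \<in> sign_vectors A"
      using assms(2) by (auto simp: sign_vectors_iff)
    then obtain s where "s \<in> L" "restrict s A = restrict p A"
      using sh unfolding shattered_by_def by (metis imageE)
    then show "\<exists>s\<in>L. \<forall>x\<in>A. s x = p x" by (metis restrict_apply')
  qed
next
  assume *: "\<forall>p\<in>sign_vectors E. \<exists>s\<in>L. \<forall>x\<in>A. s x = p x"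
  have "restrict s A \<in> sign_vectors A" if "s \<in> L" for s
    using that assms by (auto simp: sign_vectors_iff subset_iff)
  moreover have "p \<in> (\<lambda>s. restrict s A) ` L" if p: "p \<in> sign_vectors A" for p
  proof -
    \<comment> \<open>The value 1 on \<open>E - A\<close> is an arbitrary filling; only agreement on
      \<open>A\<close> matters.\<close>
    let ?q = "\<lambda>x. if x \<in> A then p x else if x \<in> E then 1 else undefined"
    have "?q \<in> sign_vectors E" using p assms(2) by (auto simp: sign_vectors_iff)
    from bspec[OF * this] obtain s where "s \<in> L" "\<forall>x\<in>A. s x = ?q x" by (rule bexE)
    then have s: "s \<in> L" "\<forall>x\<in>A. s x = p x" by auto
    then have "restrict s A = p" using p by (auto simp: sign_vectors_iff)
    with s show ?thesis by blast
  qed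
  ultimately show "shattered_by A L" unfolding shattered_by_def by blast
qed

lemma shattered_by_subset:
  "\<lbrakk>shattered_by A L; L \<subseteq> M; M \<subseteq> sign_vectors E; A \<subseteq> E\<rbrakk> \<Longrightarrow> shattered_by A M"
  by (simp add: shattered_by_iff[of L E A] shattered_by_iff[of M E A]) blast

lemma prec_trans: "\<lbrakk>prec E r s; prec E s t\<rbrakk> \<Longrightarrow> prec E r t"
  unfolding prec_def by (metis empty_iff insert_iff)

lemma prec_antisym:
  "\<lbrakk>prec E s t; prec E t s; s \<in> signed_vectors E; t \<in> signed_vectors E\<rbrakk> \<Longrightarrow> s = t"
  unfolding prec_def signed_vectors_iff fun_eq_iff by (metis empty_iff insert_iff)

lemma prec_refl: "prec E t t"
  by (simp add: prec_def)

lemma baryc_up: "\<lbrakk>t \<in> baryc E L; prec E t u; u \<in> signed_vectors E\<rbrakk> \<Longrightarrow> u \<in> baryc E L"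
  unfolding baryc_def using prec_trans by blast

lemma baryc_sub: "baryc E L \<subseteq> signed_vectors E"
  by (auto simp: baryc_def)

lemma sign_vectors_signed: "s \<in> sign_vectors E \<Longrightarrow> s \<in> signed_vectors E"
  by (auto simp: sign_vectors_iff signed_vectors_iff)

lemma prec_sign_vectors: "\<lbrakk>prec E s t; s \<in> sign_vectors E; t \<in> signed_vectors E\<rbrakk> \<Longrightarrow> t = s"
  unfolding prec_def sign_vectors_iff signed_vectors_iff fun_eq_iff
  by (metis empty_iff insert_iff zero_neq_neg_one zero_neq_one)

lemma baryc_sign_vectors: "L \<subseteq> sign_vectors E \<Longrightarrow> s \<in> L \<Longrightarrow> s \<in> baryc E L"
  using prec_sign_vectors sign_vectors_signed unfolding baryc_def by blast

section \<open>Shattering and complements\<close>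

lemma complementary_subset: "complementary E L \<subseteq> sign_vectors E"
  by (auto simp: complementary_def)

lemma complementary_complementary:
  "L \<subseteq> sign_vectors E \<Longrightarrow> complementary E (complementary E L) = L"
  by (auto simp: complementary_def)

lemma shattered_by_iff_complementary:
  assumes L: "L \<subseteq> sign_vectors E" and A: "A \<subseteq> E"
  shows "shattered_by A L \<longleftrightarrow> \<not> strongly_shattered_by E (E - A) (complementary E L)"
proof
  assume sh: "shattered_by A L"
  show "\<not> strongly_shattered_by E (E - A) (complementary E L)"
  proof
    assume "strongly_shattered_by E (E - A) (complementary E L)"
    then obtain t where t: "t \<in> baryc E (complementary E L)" "\<forall>x\<in>E - A. t x = 0"
      by (auto simp: strongly_shattered_by_def)
    \<comment> \<open>The face \<open>t\<close> constrains its vertices only on \<open>A\<close>.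
      Filling its zeros there arbitrarily gives a pattern; the member of \<open>L\<close> realizing
      it is a vertex of the face.\<close>
    let ?p = "\<lambda>x. if x \<in> E \<and> t x = 0 then 1 else t x"
    have "?p \<in> sign_vectors E"
      using t(1) baryc_sub by (auto simp: sign_vectors_iff signed_vectors_iff subset_iff)
    from bspec[OF sh[unfolded shattered_by_iff[OF L A]] this]
    obtain s where s: "s \<in> L" "\<forall>x\<in>A. s x = ?p x" by (rule bexE)
    have "prec E t s" using s(2) t(2) A by (auto simp: prec_def)
    then show False using t(1) s(1) L by (auto simp: baryc_def complementary_def)
  qed
next
  assume ns: "\<not> strongly_shattered_by E (E - A) (complementary E L)"
  have "\<exists>s\<in>L. \<forall>x\<in>A. s x = p x" if p: "p \<in> sign_vectors E" for p
  proof (rule ccontr)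
    assume no: "\<not> ?thesis"
    \<comment> \<open>Barycenter of the face of all vertices with the missed pattern on
      \<open>A\<close>.\<close>
    let ?t = "\<lambda>x. if x \<in> E - A then 0 else p x"
    have "?t \<in> signed_vectors E" using p by (auto simp: sign_vectors_iff signed_vectors_iff)
    moreover have "s \<in> complementary E L" if s: "s \<in> sign_vectors E" "prec E ?t s" for s
    proof -
      have "s x = p x" if "x \<in> A" for x
        using s(2) p A that unfolding prec_def sign_vectors_iff by fastforce
      then show ?thesis using no s by (auto simp: complementary_def)
    qed
    ultimately have "?t \<in> baryc E (complementary E L)" by (simp add: baryc_def)
    then have "strongly_shattered_by E (E - A) (complementary E L)"
      unfolding strongly_shattered_by_def by (rule bexI[rotated]) simp
    with ns show False by simp
  qed
  then show "shattered_by A L" using shattered_by_iff[OF L A] by blast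
qed

section \<open>Counting shattered sets\<close>

text \<open>\<open>L\<close> splits into its two facets at \<open>e\<close>, so its size is the sum
  of the sizes of the slices; inclusion-exclusion rewrites this sum.\<close>

lemma card_slices:
  assumes "finite E" "e \<notin> E" and L: "L \<subseteq> sign_vectors (insert e E)"
  shows "card L = card (slice E e 1 L \<union> slice E e (-1) L) + card (slice E e 1 L \<inter> slice E e (-1) L)"
proof -
  have fin: "finite (slice E e c L)" for c
    using finite_sign_vectors[OF assms(1)] by (simp add: slice_def)
  have inj: "inj_on (\<lambda>s. s(e := c)) (slice E e c L)" for c
    using assms(2)
    by (intro inj_onI ext)
      (metis (no_types, lifting) fun_upd_apply mem_Collect_eq sign_vectors_iff slice_def)
  have dec: "s \<in> (\<lambda>s. s(e := 1)) ` slice E e 1 L \<union> (\<lambda>s. s(e := -1)) ` slice E e (-1) L"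
    if s: "s \<in> L" for s
  proof -
    \<comment> \<open>Members of \<open>sign_vectors E\<close> are extensional, so forgetting
      \<open>e\<close> means resetting it to \<open>undefined\<close>.\<close>
    let ?r = "s(e := undefined)"
    have "?r \<in> sign_vectors E" using L s assms(2) by (auto simp: sign_vectors_iff subset_iff)
    moreover have "s = ?r(e := s e)" by simp
    ultimately have "s \<in> (\<lambda>r. r(e := s e)) ` slice E e (s e) L"
      using s unfolding slice_def by (metis (no_types, lifting) image_eqI mem_Collect_eq)
    moreover have "s e = 1 \<or> s e = -1" using L s by (auto simp: sign_vectors_iff)
    ultimately show ?thesis by auto
  qed
  have split: "L = (\<lambda>s. s(e := 1)) ` slice E e 1 L \<union> (\<lambda>s. s(e := -1)) ` slice E e (-1) L"
    using dec by (auto simp: slice_def)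
  have disj: "(\<lambda>s. s(e := 1)) ` slice E e 1 L \<inter> (\<lambda>s. s(e := -1)) ` slice E e (-1) L = {}"
    by (auto dest: fun_cong[where x = e])
  have "card L = card (slice E e 1 L) + card (slice E e (-1) L)"
    by (subst split, subst card_Un_disjoint) (simp_all only: fin inj disj finite_imageI card_image)
  with card_Un_Int[OF fin fin] show ?thesis by metis
qed

lemma slice_subset: "slice E e c L \<subseteq> sign_vectors E"
  by (auto simp: slice_def)

lemma shattered_by_union_slices:
  assumes "e \<notin> E" and L: "L \<subseteq> sign_vectors (insert e E)" and A: "A \<subseteq> E"
    and sh: "shattered_by A (slice E e 1 L \<union> slice E e (-1) L)"
  shows "shattered_by A L"
proof -
  have "\<exists>s\<in>L. \<forall>x\<in>A. s x = p x" if p: "p \<in> sign_vectors (insert e E)" for p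
  proof -
    have "p(e := undefined) \<in> sign_vectors E" using p assms(1) by (auto simp: sign_vectors_iff)
    then obtain r where r: "r \<in> slice E e 1 L \<union> slice E e (-1) L"
      "\<forall>x\<in>A. r x = (p(e := undefined)) x"
      using sh shattered_by_iff[OF _ A] slice_subset by (metis Un_least)
    then obtain c where "r(e := c) \<in> L" by (auto simp: slice_def)
    moreover have "\<forall>x\<in>A. (r(e := c)) x = p x" using r(2) A assms(1) by auto
    ultimately show ?thesis by blast
  qed
  then show ?thesis using shattered_by_iff[OF L] A by (meson subset_insertI2)
qed

text \<open>A vector in both slices may take either value at \<open>e\<close>, so \<open>e\<close>
  joins the shattered set.\<close>

lemma shattered_by_inter_slices:
  assumes "e \<notin> E" and L: "L \<subseteq> sign_vectors (insert e E)" and A: "A \<subseteq> E"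
    and sh: "shattered_by A (slice E e 1 L \<inter> slice E e (-1) L)"
  shows "shattered_by (insert e A) L"
proof -
  have "\<exists>s\<in>L. \<forall>x\<in>insert e A. s x = p x" if p: "p \<in> sign_vectors (insert e E)" for p
  proof -
    have "p(e := undefined) \<in> sign_vectors E" using p assms(1) by (auto simp: sign_vectors_iff)
    then obtain r where r: "r \<in> slice E e 1 L \<inter> slice E e (-1) L"
      "\<forall>x\<in>A. r x = (p(e := undefined)) x"
      using sh shattered_by_iff[OF _ A] slice_subset by (metis le_infI1)
    moreover have "p e = 1 \<or> p e = -1" using p by (auto simp: sign_vectors_iff)
    ultimately have "r(e := p e) \<in> L" by (auto simp: slice_def)
    moreover have "\<forall>x\<in>insert e A. (r(e := p e)) x = p x"
      using r(2) by auto
    ultimately show ?thesis by blast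
  qed
  then show ?thesis using shattered_by_iff[OF L] A by (meson insert_mono)
qed

text \<open>Only sets of the second family contain \<open>e\<close>, so the two families are
  disjoint. The inclusion is stated separately from the counts because ample sets turn it into an
  equality.\<close>

lemma card_shattered_slices:
  assumes "finite E" "e \<notin> E" and L: "L \<subseteq> sign_vectors (insert e E)"
  defines "U \<equiv> slice E e 1 L \<union> slice E e (-1) L"
    and "I \<equiv> slice E e 1 L \<inter> slice E e (-1) L"
  shows "card {A. A \<subseteq> E \<and> shattered_by A U} +
      card (insert e ` {A. A \<subseteq> E \<and> shattered_by A I}) =
    card ({A. A \<subseteq> E \<and> shattered_by A U} \<union> insert e ` {A. A \<subseteq> E \<and> shattered_by A I})"
    and "card (insert e ` {A. A \<subseteq> E \<and> shattered_by A I}) = card {A. A \<subseteq> E \<and> shattered_by A I}"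
    and "{A. A \<subseteq> E \<and> shattered_by A U} \<union> insert e ` {A. A \<subseteq> E \<and> shattered_by A I}
      \<subseteq> {A. A \<subseteq> insert e E \<and> shattered_by A L}"
proof -
  show "card {A. A \<subseteq> E \<and> shattered_by A U} +
      card (insert e ` {A. A \<subseteq> E \<and> shattered_by A I}) =
    card ({A. A \<subseteq> E \<and> shattered_by A U} \<union> insert e ` {A. A \<subseteq> E \<and> shattered_by A I})"
    using assms(1,2) by (intro card_Un_disjoint[symmetric]) auto
  show "card (insert e ` {A. A \<subseteq> E \<and> shattered_by A I}) = card {A. A \<subseteq> E \<and> shattered_by A I}"
    using assms(2) by (intro card_image inj_onI) (auto simp: insert_ident subset_iff)
  show "{A. A \<subseteq> E \<and> shattered_by A U} \<union> insert e ` {A. A \<subseteq> E \<and> shattered_by A I}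
      \<subseteq> {A. A \<subseteq> insert e E \<and> shattered_by A L}"
    using shattered_by_union_slices[OF assms(2) L] shattered_by_inter_slices[OF assms(2) L]
    unfolding U_def I_def by blast
qed

text \<open>Pajor's inequality, from which the Sauer-Shelah bound follows. In the induction on
  \<open>E\<close>, the bounds for the union and the intersection of the slices add up, since they
  account for different sets shattered by \<open>L\<close>.\<close>

lemma card_le_card_shattered:
  assumes "finite E" "L \<subseteq> sign_vectors E"
  shows "card L \<le> card {A. A \<subseteq> E \<and> shattered_by A L}"
  using assms
proof (induction E arbitrary: L rule: finite_induct)
  case empty
  have "sign_vectors {} = {\<lambda>_. undefined :: int}"
    by (simp add: sign_vectors_def)
  with empty consider "L = {}" | "L = sign_vectors ({} :: 'a set)"
    by (metis subset_singletonD)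
  then show ?case
  proof cases
    case 2
    then have "{A. A \<subseteq> {} \<and> shattered_by A L} = {{}}"
      using shattered_by_iff[OF empty, of "{}"] by auto
    with 2 show ?thesis by (simp add: sign_vectors_def)
  qed simp
next
  case (insert e E)
  note c = card_shattered_slices[OF insert.hyps insert.prems]
  have "finite {A. A \<subseteq> insert e E \<and> shattered_by A L}" using insert.hyps by simp
  from card_mono[OF this c(3)] c(1,2) card_slices[OF insert.hyps insert.prems]
    insert.IH[of "slice E e 1 L \<union> slice E e (-1) L"]
    insert.IH[of "slice E e 1 L \<inter> slice E e (-1) L"]
  show ?case using slice_subset[of E e _ L] by (simp add: le_infI1)
qed

section \<open>Equality in the count and strong shattering\<close>

lemma baryc_inter_slices:
  assumes "e \<notin> E" and t: "t \<in> baryc E (slice E e 1 L \<inter> slice E e (-1) L)"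
  shows "t(e := 0) \<in> baryc (insert e E) L"
proof -
  have "t(e := 0) \<in> signed_vectors (insert e E)"
    using t assms(1) by (auto simp: baryc_def signed_vectors_iff)
  moreover have "s \<in> L" if s: "s \<in> sign_vectors (insert e E)" "prec (insert e E) (t(e := 0)) s" for s
  proof -
    \<comment> \<open>Without \<open>e\<close>, \<open>s\<close> is a vertex of the face
      \<open>t\<close>, hence marks an edge in direction \<open>e\<close>; both ends of it, one of
      which is \<open>s\<close>, lie in \<open>L\<close>.\<close>
    have "s(e := undefined) \<in> sign_vectors E" using s(1) assms(1) by (auto simp: sign_vectors_iff)
    moreover have "prec E t (s(e := undefined))"
      using s(2) assms(1) by (auto simp: prec_def)
    ultimately have "s(e := undefined) \<in> slice E e 1 L \<inter> slice E e (-1) L"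
      using t by (auto simp: baryc_def)
    then have "s(e := 1) \<in> L" "s(e := -1) \<in> L" by (auto simp: slice_def)
    moreover have "s e = 1 \<or> s e = -1" using s(1) by (auto simp: sign_vectors_iff)
    ultimately show ?thesis by (metis fun_upd_triv)
  qed
  ultimately show ?thesis by (simp add: baryc_def)
qed

text \<open>Equality in Pajor's inequality for \<open>L\<close> is inherited by the set of edges in
  a direction \<open>e\<close> of \<open>A\<close>. The induction removes \<open>e\<close> from
  \<open>A\<close> and passes to that set, and a face found there is widened along
  \<open>e\<close>.\<close>

lemma ample_strongly_shattered:
  assumes "finite A" "finite E" "L \<subseteq> sign_vectors E" "ample E L" "A \<subseteq> E" "shattered_by A L"
  shows "strongly_shattered_by E A L"
  using assms
proof (induction A arbitrary: E L rule: finite_induct)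
  case empty
  \<comment> \<open>Shattering the empty set says that \<open>L\<close> is nonempty; the pattern is
    an arbitrary choice.\<close>
  have "(\<lambda>x\<in>E. 1) \<in> sign_vectors E" by (auto simp: sign_vectors_iff)
  with shattered_by_iff[of L E "{}"] empty obtain s where "s \<in> L" by auto
  then show ?case using baryc_sign_vectors empty by (auto simp: strongly_shattered_by_def)
next
  case (insert e A)
  let ?F = "E - {e}"
  have F: "insert e ?F = E" "finite ?F" "e \<notin> ?F" using insert.prems by auto
  have L: "L \<subseteq> sign_vectors (insert e ?F)" using F insert.prems by simp
  let ?U = "slice ?F e 1 L \<union> slice ?F e (-1) L" and ?I = "slice ?F e 1 L \<inter> slice ?F e (-1) L"
  let ?sU = "{A. A \<subseteq> ?F \<and> shattered_by A ?U}" and ?sI = "{A. A \<subseteq> ?F \<and> shattered_by A ?I}"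
    and ?sL = "{A. A \<subseteq> E \<and> shattered_by A L}"
  have sub: "?U \<subseteq> sign_vectors ?F" "?I \<subseteq> sign_vectors ?F" using slice_subset[of ?F e _ L] by auto
  note c = card_shattered_slices[OF F(2,3) L, unfolded F(1)]
  have finL: "finite ?sL" using insert.prems by simp
  have "card L = card ?sL" using insert.prems by (simp add: ample_def)
  \<comment> \<open>Ampleness closes the chain \<open>card L\<close> =
    \<open>card ?U + card ?I\<close> \<le> \<open>card ?sU + card ?sI\<close> \<le>
    \<open>card ?sL\<close>, so every bound in it is an equality.\<close>
  then have eqs: "card ?I = card ?sI" "card ?sL \<le> card (?sU \<union> insert e ` ?sI)"
    using card_mono[OF finL c(3)] c(1,2) card_slices[OF F(2,3) L]
      card_le_card_shattered[OF F(2) sub(1)] card_le_card_shattered[OF F(2) sub(2)]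
    by linarith+
  have "?sU \<union> insert e ` ?sI = ?sL" using card_seteq[OF finL c(3) eqs(2)] .
  moreover have "insert e A \<in> ?sL" using insert.prems by simp
  ultimately have "insert e A \<in> ?sU \<union> insert e ` ?sI" by (simp only:)
  \<comment> \<open>A set containing \<open>e\<close> cannot belong to \<open>?sU\<close>, whose
    members avoid \<open>e\<close>.\<close>
  then obtain B where B: "B \<subseteq> ?F" "shattered_by B ?I" "insert e A = insert e B" by auto
  then have "B = A" using insert.hyps by (metis F(3) insert_ident subsetD)
  with B have "strongly_shattered_by ?F A ?I"
    using insert.IH[OF F(2) sub(2)] eqs(1) by (simp add: ample_def)
  then obtain t where t: "t \<in> baryc ?F ?I" "\<forall>x\<in>A. t x = 0"
    by (auto simp: strongly_shattered_by_def)
  have "t(e := 0) \<in> baryc E L" using baryc_inter_slices[OF F(3) t(1)] F(1) by simp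
  moreover have "\<forall>x\<in>insert e A. (t(e := 0)) x = 0" using t(2) by simp
  ultimately show ?case unfolding strongly_shattered_by_def by blast
qed

text \<open>Pajor's inequality for the complement of \<open>L\<close>: taking complements in
  \<open>E\<close> matches the sets it shatters with the sets not strongly shattered by
  \<open>L\<close>, and both sides are subtracted from \<open>2 ^ card E\<close>.\<close>

lemma card_strongly_shattered_le:
  assumes E: "finite E" and L: "L \<subseteq> sign_vectors E"
  shows "card {A. A \<subseteq> E \<and> strongly_shattered_by E A L} \<le> card L"
proof -
  let ?M = "complementary E L"
  let ?S = "{A. A \<subseteq> E \<and> strongly_shattered_by E A L}" and ?T = "{A. A \<subseteq> E \<and> shattered_by A ?M}"
  have T: "A \<in> ?T \<longleftrightarrow> E - A \<notin> ?S" if "A \<subseteq> E" for A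
    using shattered_by_iff_complementary[OF complementary_subset that, of L] that
    by (simp add: complementary_complementary[OF L])
  then have "?T = (\<lambda>A. E - A) ` (Pow E - ?S)"
    by (auto simp: image_iff) (metis Diff_subset double_diff order_refl)+
  moreover have "inj_on (\<lambda>A. E - A) (Pow E - ?S)"
    by (rule inj_onI) (metis DiffD1 PowD double_diff order_refl)
  ultimately have "card ?T = card (Pow E - ?S)" by (simp add: card_image)
  also have "\<dots> = 2 ^ card E - card ?S"
    using E by (subst card_Diff_subset) (auto simp: card_Pow)
  finally have "card ?T = 2 ^ card E - card ?S" .
  \<comment> \<open>Subtraction of naturals truncates; this bound and the one on
    \<open>card L\<close> allow the inequality to be reversed.\<close>
  moreover have "card ?S \<le> 2 ^ card E"
    using card_mono[of "Pow E" ?S] E by (auto simp: card_Pow)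
  moreover have "card (sign_vectors E) = 2 ^ card E"
    using E by (simp add: sign_vectors_def card_PiE numeral_2_eq_2)
  moreover have "card ?M = card (sign_vectors E) - card L"
    using L finite_subset[OF L finite_sign_vectors[OF E]]
    by (simp add: complementary_def card_Diff_subset)
  moreover have "card L \<le> card (sign_vectors E)"
    using card_mono[OF finite_sign_vectors[OF E] L] .
  ultimately show ?thesis
    using card_le_card_shattered[OF E complementary_subset, of L] by linarith
qed

text \<open>The working form of ampleness from here on. Backwards, \<open>card L\<close> is squeezed
  between the two counts.\<close>

lemma ample_iff:
  assumes E: "finite E" and L: "L \<subseteq> sign_vectors E"
  shows "ample E L \<longleftrightarrow> (\<forall>A\<subseteq>E. shattered_by A L \<longrightarrow> strongly_shattered_by E A L)"
proof
  assume "ample E L"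
  then show "\<forall>A\<subseteq>E. shattered_by A L \<longrightarrow> strongly_shattered_by E A L"
    using ample_strongly_shattered[OF _ E L] finite_subset[OF _ E] by blast
next
  assume "\<forall>A\<subseteq>E. shattered_by A L \<longrightarrow> strongly_shattered_by E A L"
  then have "card {A. A \<subseteq> E \<and> shattered_by A L} \<le> card {A. A \<subseteq> E \<and> strongly_shattered_by E A L}"
    using E by (intro card_mono) auto
  then show "ample E L"
    using card_strongly_shattered_le[OF E L] card_le_card_shattered[OF E L]
    by (simp add: ample_def)
qed

section \<open>Complements of ample sets\<close>

lemma ample_complementary:
  assumes E: "finite E" and L: "L \<subseteq> sign_vectors E" and a: "ample E L"
  shows "ample E (complementary E L)"
  unfolding ample_iff[OF E complementary_subset]
proof (intro allI impI)
  fix A assume A: "A \<subseteq> E" "shattered_by A (complementary E L)"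
  \<comment> \<open>The duality is used twice, around the contrapositive of the criterion for
    \<open>L\<close> at \<open>E - A\<close>.\<close>
  then have "\<not> strongly_shattered_by E (E - A) L"
    using shattered_by_iff_complementary[OF complementary_subset A(1)]
      complementary_complementary[OF L] by metis
  then have "\<not> shattered_by (E - A) L" using a ample_iff[OF E L] by blast
  then show "strongly_shattered_by E A (complementary E L)"
    using shattered_by_iff_complementary[OF L, of "E - A"] A(1) by (simp add: double_diff)
qed

lemma ample_complementary_iff:
  assumes "finite E" "L \<subseteq> sign_vectors E"
  shows "ample E (complementary E L) \<longleftrightarrow> ample E L"
  using ample_complementary[OF assms] ample_complementary[OF assms(1) complementary_subset]
    complementary_complementary[OF assms(2)] by metis

section \<open>Faces of ample sets\<close>

text \<open>A face of \<open>L\<close> free on \<open>A\<close> yields one inside the facet unless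
  it lies in the opposite facet. In that case \<open>insert g A\<close> is shattered by
  \<open>L\<close>, and a face that is also free at \<open>g\<close> replaces it.\<close>

lemma ample_facet:
  assumes E: "finite E" and L: "L \<subseteq> sign_vectors E" and a: "ample E L"
    and g: "g \<in> E" and c: "c = 1 \<or> c = -1"
  shows "ample E {s \<in> L. s g = c}"
proof -
  let ?M = "{s \<in> L. s g = c}"
  have M: "?M \<subseteq> sign_vectors E" using L by blast
  have lift: "strongly_shattered_by E A ?M"
    if t: "t \<in> baryc E L" "\<forall>x\<in>A. t x = 0" "t g \<in> {0, c}" and "g \<notin> A" for A t
  proof -
    have u: "t(g := c) \<in> signed_vectors E"
      using t(1) baryc_sub g c by (auto simp: signed_vectors_iff subset_iff)
    then have "t(g := c) \<in> baryc E L"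
      using t by (intro baryc_up[OF t(1)]) (auto simp: prec_def)
    moreover have "s g = c" if "prec E (t(g := c)) s" for s
      using that g c by (auto simp: prec_def)
    ultimately have "t(g := c) \<in> baryc E ?M" by (auto simp: baryc_def)
    moreover have "\<forall>x\<in>A. (t(g := c)) x = 0" using t(2) \<open>g \<notin> A\<close> by auto
    ultimately show ?thesis unfolding strongly_shattered_by_def by blast
  qed
  have "strongly_shattered_by E A ?M" if A: "A \<subseteq> E" "shattered_by A ?M" for A
  proof -
    have pat: "\<exists>s\<in>L. s g = c \<and> (\<forall>x\<in>A. s x = p x)" if "p \<in> sign_vectors E" for p
      using A that shattered_by_iff[OF M A(1)] by fastforce
    have gA: "g \<notin> A"
    proof
      assume "g \<in> A"
      \<comment> \<open>All members of the facet have value \<open>c\<close> at \<open>g\<close>, so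
        a pattern with \<open>-c\<close> there is missed.\<close>
      have "(\<lambda>x\<in>E. -c) \<in> sign_vectors E" using c by (auto simp: sign_vectors_iff)
      from pat[OF this] obtain s where "s g = c" "\<forall>x\<in>A. s x = (\<lambda>x\<in>E. -c) x" by blast
      then have "c = -c" using \<open>g \<in> A\<close> g by (metis restrict_apply')
      with c show False by simp
    qed
    have "shattered_by A L" using shattered_by_subset[OF A(2) _ L A(1)] by blast
    then obtain t where t: "t \<in> baryc E L" "\<forall>x\<in>A. t x = 0"
      using a ample_iff[OF E L] A(1) by (auto simp: strongly_shattered_by_def)
    show ?thesis
    proof (cases "t g = -c")
      case False
      then have "t g \<in> {0, c}"
        using t(1) baryc_sub c g by (fastforce simp: signed_vectors_iff subset_iff)
      then show ?thesis using lift t gA by blast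
    next
      case True
      \<comment> \<open>The face \<open>t\<close> shatters \<open>A\<close> on the side \<open>- c\<close> of \<open>g\<close>, the hypothesis does so on the side \<open>c\<close>;
        so \<open>insert g A\<close> is shattered.\<close>
      have "\<exists>s\<in>L. \<forall>x\<in>insert g A. s x = p x" if p: "p \<in> sign_vectors E" for p
      proof (cases "p g = c")
        case True
        then show ?thesis using pat[OF p] by auto
      next
        case False
        then have pg: "p g = -c" using p g c by (auto simp: sign_vectors_iff)
        let ?s = "\<lambda>x. if x \<in> E \<and> t x \<noteq> 0 then t x else p x"
        have "?s \<in> sign_vectors E" "prec E t ?s"
          using p t(1) baryc_sub by (auto simp: sign_vectors_iff signed_vectors_iff subset_iff prec_def)
        then have "?s \<in> L" using t(1) by (auto simp: baryc_def)
        moreover have "\<forall>x\<in>insert g A. ?s x = p x" using t(2) pg \<open>t g = -c\<close> by simp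
        ultimately show ?thesis by (intro bexI[of _ ?s])
      qed
      then have "shattered_by (insert g A) L"
        using shattered_by_iff[OF L, of "insert g A"] A(1) g by blast
      then obtain u where "u \<in> baryc E L" "\<forall>x\<in>insert g A. u x = 0"
        using a ample_iff[OF E L] A(1) g by (metis insert_subset strongly_shattered_by_def)
      then show ?thesis using lift gA by auto
    qed
  qed
  then show ?thesis using ample_iff[OF E M] by blast
qed

lemma ample_face:
  assumes E: "finite E" and L: "L \<subseteq> sign_vectors E" and a: "ample E L"
    and G: "finite G" "G \<subseteq> E" "\<forall>x\<in>G. c x = 1 \<or> c x = -1"
  shows "ample E {s \<in> L. \<forall>x\<in>G. s x = c x}"
  using G
proof (induction G rule: finite_induct)
  case empty
  then show ?case using a by simp
next
  case (insert g G)
  then have "ample E {s \<in> {s \<in> L. \<forall>x\<in>G. s x = c x}. s g = c g}"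
    using L by (intro ample_facet[OF E]) auto
  moreover have "{s \<in> {s \<in> L. \<forall>x\<in>G. s x = c x}. s g = c g} = {s \<in> L. \<forall>x\<in>insert g G. s x = c x}"
    by auto
  ultimately show ?case by simp
qed

section \<open>The signed-circuit axiom\<close>

lemma ample_imp_signed_circuit_axiom:
  assumes E: "finite E" and L: "L \<subseteq> sign_vectors E" and a: "ample E L"
  shows "signed_circuit_axiom E (baryc E L)"
  unfolding signed_circuit_axiom_def
proof (intro ballI impI)
  fix t' t'' e assume t: "t' \<in> baryc E L" "t'' \<in> baryc E L" and e: "e \<in> E" "t' e * t'' e = -1"
  have sv: "t' \<in> signed_vectors E" "t'' \<in> signed_vectors E" using t baryc_sub by auto
  define Z where "Z = {x \<in> E. t' x = 0 \<and> t'' x = 0}"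
  \<comment> \<open>The sum vanishes where both vectors are 0 or they are opposite. On
    \<open>G\<close> they do not contradict each other, and \<open>c\<close> is the nonzero value
    present.\<close>
  define G where "G = {x \<in> E. t' x + t'' x \<noteq> 0}"
  define c where "c x = (if t' x = 0 then t'' x else t' x)" for x
  define M where "M = {s \<in> L. \<forall>x\<in>G. s x = c x}"
  have cG: "\<forall>x\<in>G. c x = 1 \<or> c x = -1"
    using sv by (auto simp: G_def c_def signed_vectors_iff)
  have GE: "G \<subseteq> E" "finite G" using E by (auto simp: G_def)
  have M: "M \<subseteq> sign_vectors E" using L by (auto simp: M_def)
  have aM: "ample E M" unfolding M_def using ample_face[OF E L a GE(2,1) cG] .
  have ee: "t' e = 1 \<and> t'' e = -1 \<or> t' e = -1 \<and> t'' e = 1"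
    using sv e by (auto simp: signed_vectors_iff)
  have ZE: "insert e Z \<subseteq> E" using e by (auto simp: Z_def)
  \<comment> \<open>Here \<open>u\<close> stands for \<open>t'\<close> or \<open>t''\<close>,
    whichever has the sign \<open>p e\<close>: completed by \<open>c\<close> on \<open>G\<close> and
    by \<open>p\<close> elsewhere, it becomes a member of \<open>M\<close> with the required
    pattern.\<close>
  have fill: "\<exists>s\<in>M. \<forall>x\<in>insert e Z. s x = p x"
    if p: "p \<in> sign_vectors E" and u: "u \<in> baryc E L" "\<forall>x\<in>Z. u x = 0" "u e = p e"
      "\<forall>x\<in>G. u x \<in> {0, c x}" for p u
  proof -
    let ?s = "\<lambda>x. if x \<in> E \<and> u x \<noteq> 0 then u x else if x \<in> G then c x else p x"
    have "?s \<in> sign_vectors E" "prec E u ?s"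
      using p u(1) baryc_sub cG GE by (auto simp: sign_vectors_iff signed_vectors_iff subset_iff prec_def)
    then have "?s \<in> L" using u(1) by (auto simp: baryc_def)
    moreover have "\<forall>x\<in>G. ?s x = c x" using u(4) by auto
    moreover have "e \<notin> G" "\<And>x. x \<in> Z \<Longrightarrow> x \<notin> G" using ee by (auto simp: G_def Z_def)
    then have "\<forall>x\<in>insert e Z. ?s x = p x" using u(2,3) by simp
    ultimately show ?thesis unfolding M_def by (intro bexI[of _ ?s] CollectI conjI)
  qed
  have "t' x \<in> {0, c x}" for x by (auto simp: c_def)
  moreover have "\<forall>x\<in>G. t'' x \<in> {0, c x}"
    using sv by (fastforce simp: G_def c_def signed_vectors_iff)
  moreover have "t' e = p e \<or> t'' e = p e" if "p \<in> sign_vectors E" for p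
    using that ee e by (auto simp: sign_vectors_iff)
  ultimately have "\<exists>s\<in>M. \<forall>x\<in>insert e Z. s x = p x" if "p \<in> sign_vectors E" for p
    using that fill[OF that t(1)] fill[OF that t(2)] unfolding Z_def by blast
  then have "shattered_by (insert e Z) M" using shattered_by_iff[OF M ZE] by blast
  then obtain t where t0: "t \<in> baryc E M" "\<forall>x\<in>insert e Z. t x = 0"
    using aM ample_iff[OF E M] ZE by (metis strongly_shattered_by_def)
  then have tL: "t \<in> baryc E L" by (auto simp: baryc_def M_def)
  have tv: "t \<in> signed_vectors E" using tL baryc_sub by auto
  have tG: "t x \<in> {0, c x}" if x: "x \<in> G" for x
  proof -
    \<comment> \<open>Any vertex of the face \<open>t\<close> lies in \<open>M\<close>, so a nonzero
      value of \<open>t\<close> on \<open>G\<close> is the prescribed one.\<close>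
    let ?s = "\<lambda>x. if x \<in> E \<and> t x = 0 then 1 else t x"
    have "?s \<in> sign_vectors E" "prec E t ?s"
      using tv by (auto simp: sign_vectors_iff signed_vectors_iff prec_def)
    then have "?s \<in> M" using t0(1) by (auto simp: baryc_def)
    then have "?s x = c x" using x unfolding M_def by blast
    then show ?thesis by (auto split: if_splits)
  qed
  have "t f \<in> {0, t' f, t'' f}" if f: "f \<in> E" for f
  proof (cases "f \<in> G")
    case True
    then show ?thesis using tG[OF True] by (auto simp: c_def split: if_splits)
  next
    case False
    \<comment> \<open>Off \<open>G\<close> and \<open>Z\<close> the two signs are opposite, so every
      value of \<open>t\<close> is permitted.\<close>
    have "f \<in> Z \<or> t' f = 1 \<and> t'' f = -1 \<or> t' f = -1 \<and> t'' f = 1"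
      using False f sv by (auto simp: Z_def G_def signed_vectors_iff)
    then show ?thesis using t0(2) tv f by (auto simp: signed_vectors_iff)
  qed
  then show "\<exists>t\<in>baryc E L. t e = 0 \<and> (\<forall>f\<in>E. t f \<in> {0, t' f, t'' f})"
    using tL t0(2) by blast
qed

lemma signed_circuit_axiom_imp_ample:
  assumes E: "finite E" and L: "L \<subseteq> sign_vectors E"
    and sca: "signed_circuit_axiom E (baryc E L)"
  shows "ample E L"
  unfolding ample_iff[OF E L]
proof (intro allI impI)
  fix A assume A: "A \<subseteq> E" "shattered_by A L"
  \<comment> \<open>\<open>Z\<close> is the part already eliminated. The pattern \<open>p\<close> on
    the rest stays arbitrary, so that the induction supplies both signs at the next element.\<close>
  have "\<exists>t\<in>baryc E L. (\<forall>x\<in>Z. t x = 0) \<and> (\<forall>x\<in>A - Z. t x = p x)"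
    if "finite Z" "Z \<subseteq> A" "p \<in> sign_vectors E" for Z p
    using that
  proof (induction Z arbitrary: p rule: finite_induct)
    case empty
    then obtain s where "s \<in> L" "\<forall>x\<in>A. s x = p x"
      using A(2) shattered_by_iff[OF L A(1)] by blast
    then show ?case using baryc_sign_vectors[OF L] by (intro bexI[of _ s]) auto
  next
    case (insert e Z)
    have e: "e \<in> A - Z" "e \<in> E" using insert A(1) by auto
    have p: "p(e := 1) \<in> sign_vectors E" "p(e := -1) \<in> sign_vectors E"
      using insert.prems e by (auto simp: sign_vectors_iff)
    have "Z \<subseteq> A" using insert.prems by blast
    from insert.IH[OF this p(1)] obtain t' where
      t': "t' \<in> baryc E L" "\<forall>x\<in>Z. t' x = 0" "\<forall>x\<in>A - Z. t' x = (p(e := 1)) x" by blast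
    from insert.IH[OF \<open>Z \<subseteq> A\<close> p(2)] obtain t'' where
      t'': "t'' \<in> baryc E L" "\<forall>x\<in>Z. t'' x = 0" "\<forall>x\<in>A - Z. t'' x = (p(e := -1)) x" by blast
    have "t' e * t'' e = -1" using t'(3) t''(3) e by auto
    then obtain t where t: "t \<in> baryc E L" "t e = 0" "\<forall>f\<in>E. t f \<in> {0, t' f, t'' f}"
      using sca t'(1) t''(1) e unfolding signed_circuit_axiom_def by blast
    \<comment> \<open>Elimination may create zeros on the rest of \<open>A\<close>; restoring
      \<open>p\<close> there moves up in the order and so stays among the barycenters.\<close>
    let ?u = "\<lambda>x. if x \<in> A - insert e Z then p x else t x"
    have pt: "t x \<in> {0, p x}" if "x \<in> A - insert e Z" for x
    proof -
      have "x \<in> E" "x \<in> A - Z" "x \<noteq> e" using that A(1) by auto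
      then show ?thesis using t(3) t'(3) t''(3) by fastforce
    qed
    have "?u \<in> signed_vectors E"
      using t(1) baryc_sub insert.prems A(1)
      by (auto simp: sign_vectors_iff signed_vectors_iff subset_iff)
    moreover have "prec E t ?u" using pt by (auto simp: prec_def)
    ultimately have "?u \<in> baryc E L" using baryc_up[OF t(1)] by blast
    moreover have "\<forall>x\<in>insert e Z. ?u x = 0"
      using t(2,3) t'(2) t''(2) insert.prems A(1) by fastforce
    ultimately show ?case by (intro bexI[of _ ?u]) auto
  qed
  from this[of A "\<lambda>x\<in>E. 1"] show "strongly_shattered_by E A L"
    using finite_subset[OF A(1) E]
    unfolding strongly_shattered_by_def by (auto simp: sign_vectors_iff)
qed

section \<open>Minimal elements and up-sets\<close>

lemma min_elements_below:
  assumes E: "finite E" and J: "J \<subseteq> signed_vectors E" and "t \<in> J"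
  shows "\<exists>u\<in>min_elements E J. prec E u t"
  using assms(3)
proof (induction "card {x \<in> E. t x \<noteq> 0}" arbitrary: t rule: less_induct)
  case less
  show ?case
  proof (cases "t \<in> min_elements E J")
    case True
    then show ?thesis using prec_refl by blast
  next
    case False
    then obtain u where u: "u \<in> J" "prec E u t" "u \<noteq> t"
      using less.prems by (auto simp: min_elements_def)
    \<comment> \<open>Distinct extensional vectors differ inside \<open>E\<close>; there
      \<open>u\<close> is 0 and \<open>t\<close> is not, so the support shrinks.\<close>
    have "\<exists>x\<in>E. u x \<noteq> t x"
      using u J less.prems unfolding signed_vectors_iff subset_iff by (metis ext)
    then have "{x \<in> E. u x \<noteq> 0} \<subset> {x \<in> E. t x \<noteq> 0}"
      using u(2) unfolding prec_def by force
    then have "card {x \<in> E. u x \<noteq> 0} < card {x \<in> E. t x \<noteq> 0}"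
      using E by (intro psubset_card_mono) auto
    then show ?thesis using less.hyps u prec_trans by blast
  qed
qed

text \<open>A minimal element below an eliminating vector still vanishes at \<open>e\<close> and
  obeys the same sign constraints.\<close>

lemma signed_circuit_axiom_min_elements:
  assumes "finite E" "J \<subseteq> signed_vectors E" "signed_circuit_axiom E J"
  shows "signed_circuit_axiom E (min_elements E J)"
  unfolding signed_circuit_axiom_def
proof (intro ballI impI)
  fix t' t'' e assume "t' \<in> min_elements E J" "t'' \<in> min_elements E J" "e \<in> E" "t' e * t'' e = -1"
  then obtain t where t: "t \<in> J" "t e = 0" "\<forall>f\<in>E. t f \<in> {0, t' f, t'' f}"
    using assms(3) unfolding signed_circuit_axiom_def min_elements_def by blast
  then obtain u where "u \<in> min_elements E J" "prec E u t"
    using min_elements_below[OF assms(1,2)] by blast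
  then show "\<exists>t\<in>min_elements E J. t e = 0 \<and> (\<forall>f\<in>E. t f \<in> {0, t' f, t'' f})"
    using t \<open>e \<in> E\<close> unfolding prec_def by (metis empty_iff insert_iff)
qed

text \<open>Elements of \<open>J\<close> below the two given vectors either have opposite signs at
  \<open>e\<close> and are eliminated in \<open>J\<close>, or one of them already vanishes at
  \<open>e\<close> and is the witness.\<close>

lemma signed_circuit_axiom_up_set:
  assumes J: "J \<subseteq> signed_vectors E" "signed_circuit_axiom E J"
  shows "signed_circuit_axiom E (up_set E J)"
  unfolding signed_circuit_axiom_def
proof (intro ballI impI)
  have J_up: "J \<subseteq> up_set E J" using J(1) prec_refl by (auto simp: up_set_def)
  fix t' t'' e assume t: "t' \<in> up_set E J" "t'' \<in> up_set E J" "e \<in> E" "t' e * t'' e = -1"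
  then obtain j' j'' where j: "j' \<in> J" "prec E j' t'" "j'' \<in> J" "prec E j'' t''"
    by (auto simp: up_set_def)
  have "\<exists>u\<in>J. u e = 0 \<and> (\<forall>f\<in>E. u f \<in> {0, t' f, t'' f})"
  proof (cases "j' e = 0 \<or> j'' e = 0")
    case True
    then show ?thesis using j unfolding prec_def by blast
  next
    case False
    then have "j' e * j'' e = -1" using j t unfolding prec_def by (metis empty_iff insert_iff)
    then obtain u where "u \<in> J" "u e = 0" "\<forall>f\<in>E. u f \<in> {0, j' f, j'' f}"
      using J(2) j t(3) unfolding signed_circuit_axiom_def by blast
    then show ?thesis using j unfolding prec_def by (metis empty_iff insert_iff)
  qed
  then show "\<exists>t\<in>up_set E J. t e = 0 \<and> (\<forall>f\<in>E. t f \<in> {0, t' f, t'' f})" using J_up by blast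
qed

lemma up_set_cocirc:
  assumes "finite E"
  shows "up_set E (cocirc E L) = baryc E L"
  using min_elements_below[OF assms baryc_sub] baryc_up baryc_sub
  unfolding up_set_def cocirc_def min_elements_def by blast

lemma signed_circuit_axiom_cocirc_iff:
  assumes "finite E"
  shows "signed_circuit_axiom E (cocirc E L) \<longleftrightarrow> signed_circuit_axiom E (baryc E L)"
proof
  have "cocirc E L \<subseteq> signed_vectors E"
    using baryc_sub by (auto simp: cocirc_def min_elements_def)
  then show "signed_circuit_axiom E (cocirc E L) \<Longrightarrow> signed_circuit_axiom E (baryc E L)"
    using signed_circuit_axiom_up_set up_set_cocirc[OF assms] by metis
  show "signed_circuit_axiom E (baryc E L) \<Longrightarrow> signed_circuit_axiom E (cocirc E L)"
    unfolding cocirc_def by (rule signed_circuit_axiom_min_elements[OF assms baryc_sub])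
qed

text \<open>For a barycenter \<open>t\<close> with a zero at \<open>e\<close>, both fillings of this
  zero lie in the up-set by induction on the number of zeros; eliminating \<open>e\<close> between
  them gives a vector below \<open>t\<close>.\<close>

lemma baryc_up_set:
  assumes E: "finite E" and J: "J \<subseteq> signed_vectors E" "signed_circuit_axiom E J"
  shows "baryc E (up_set E J \<inter> sign_vectors E) = up_set E J"
proof
  show "up_set E J \<subseteq> baryc E (up_set E J \<inter> sign_vectors E)"
  proof
    fix t assume t: "t \<in> up_set E J"
    have "s \<in> up_set E J" if "s \<in> sign_vectors E" "prec E t s" for s
      using t that prec_trans sign_vectors_signed unfolding up_set_def by blast
    then show "t \<in> baryc E (up_set E J \<inter> sign_vectors E)"
      using t by (auto simp: baryc_def up_set_def)
  qed
  have "t \<in> up_set E J" if "t \<in> baryc E (up_set E J \<inter> sign_vectors E)" for t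
    using that
  proof (induction "card {x \<in> E. t x = 0}" arbitrary: t rule: less_induct)
    case less
    have tv: "t \<in> signed_vectors E" using less.prems baryc_sub by blast
    show ?case
    proof (cases "\<exists>e\<in>E. t e = 0")
      case False
      then have "t \<in> sign_vectors E" using tv by (auto simp: sign_vectors_iff signed_vectors_iff)
      then show ?thesis using less.prems prec_refl by (auto simp: baryc_def)
    next
      case True
      then obtain e where e: "e \<in> E" "t e = 0" by blast
      have "t(e := c) \<in> up_set E J" if c: "c = 1 \<or> c = -1" for c
      proof (rule less.hyps)
        have "{x \<in> E. (t(e := c)) x = 0} \<subset> {x \<in> E. t x = 0}" using e c by auto
        then show "card {x \<in> E. (t(e := c)) x = 0} < card {x \<in> E. t x = 0}"
          using E by (intro psubset_card_mono) auto
        show "t(e := c) \<in> baryc E (up_set E J \<inter> sign_vectors E)"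
          using tv e c by (intro baryc_up[OF less.prems]) (auto simp: prec_def signed_vectors_iff)
      qed
      moreover have "(t(e := 1)) e * (t(e := -1)) e = -1" by simp
      ultimately obtain u where u: "u \<in> up_set E J" "u e = 0"
        "\<forall>f\<in>E. u f \<in> {0, (t(e := 1)) f, (t(e := -1)) f}"
        using signed_circuit_axiom_up_set[OF J] e(1) unfolding signed_circuit_axiom_def by blast
      then have "prec E u t" unfolding prec_def by fastforce
      then show ?thesis using u(1) tv prec_trans unfolding up_set_def by blast
    qed
  qed
  then show "baryc E (up_set E J \<inter> sign_vectors E) \<subseteq> up_set E J" by blast
qed

lemma min_elements_up_set:
  assumes J: "J \<subseteq> signed_vectors E" "min_elements E J = J"
  shows "min_elements E (up_set E J) = J"
proof
  have J_up: "J \<subseteq> up_set E J" using J(1) prec_refl by (auto simp: up_set_def)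
  show "min_elements E (up_set E J) \<subseteq> J"
    using J_up by (fastforce simp: min_elements_def up_set_def)
  show "J \<subseteq> min_elements E (up_set E J)"
  proof
    fix j assume j: "j \<in> J"
    have "t = j" if t: "t \<in> up_set E J" "prec E t j" for t
    proof -
      \<comment> \<open>Minimality within \<open>J\<close> forces \<open>i = j\<close>, which traps
        \<open>t\<close> between \<open>j\<close> and itself.\<close>
      obtain i where i: "i \<in> J" "prec E i t" using t(1) by (auto simp: up_set_def)
      then have "i = j" using prec_trans[OF i(2) t(2)] J(2) j by (auto simp: min_elements_def)
      then show ?thesis
        using prec_antisym i t J(1) j by (auto simp: up_set_def)
    qed
    then show "j \<in> min_elements E (up_set E J)" using j J_up by (auto simp: min_elements_def)
  qed
qed

section \<open>The equivalences and the reconstruction of \<open>L\<close> from its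
  cocircuits\<close>

lemma ample_iff_signed_circuit_axiom:
  assumes "finite E" "L \<subseteq> sign_vectors E"
  shows "ample E L \<longleftrightarrow> signed_circuit_axiom E (baryc E L)"
  using ample_imp_signed_circuit_axiom[OF assms] signed_circuit_axiom_imp_ample[OF assms] by blast

theorem theorem5:
  fixes E :: "'a set"
  assumes "finite E"
  shows
    "(\<forall>L. L \<subseteq> sign_vectors E \<longrightarrow>
        (ample E L \<longleftrightarrow> signed_circuit_axiom E (baryc E L)) \<and>
        (ample E L \<longleftrightarrow> signed_circuit_axiom E (cocirc E L)) \<and>
        (ample E L \<longleftrightarrow> signed_circuit_axiom E (baryc E (complementary E L))) \<and>
        (ample E L \<longleftrightarrow> signed_circuit_axiom E (circ E L))) \<and>
     (\<forall>J. J \<subseteq> signed_vectors E \<and> signed_circuit_axiom E J \<and> min_elements E J = J \<longrightarrow>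
        ample E (up_set E J \<inter> sign_vectors E) \<and>
        cocirc E (up_set E J \<inter> sign_vectors E) = J)"
proof (intro conjI allI impI)
  fix L assume L: "L \<subseteq> sign_vectors E"
  show b: "ample E L \<longleftrightarrow> signed_circuit_axiom E (baryc E L)"
    using ample_iff_signed_circuit_axiom[OF assms L] .
  then show "ample E L \<longleftrightarrow> signed_circuit_axiom E (cocirc E L)"
    using signed_circuit_axiom_cocirc_iff[OF assms] by blast
  show b': "ample E L \<longleftrightarrow> signed_circuit_axiom E (baryc E (complementary E L))"
    using ample_iff_signed_circuit_axiom[OF assms complementary_subset]
      ample_complementary_iff[OF assms L] by blast
  then show "ample E L \<longleftrightarrow> signed_circuit_axiom E (circ E L)"
    using signed_circuit_axiom_cocirc_iff[OF assms] unfolding circ_def by blast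
next
  fix J assume "J \<subseteq> signed_vectors E \<and> signed_circuit_axiom E J \<and> min_elements E J = J"
  then have J: "J \<subseteq> signed_vectors E" "signed_circuit_axiom E J" "min_elements E J = J" by auto
  \<comment> \<open>By \<open>b\<close> the barycenters of the new set are exactly
    \<open>up_set E J\<close>, so ampleness reduces to the axiom for the up-set and the cocircuits
    are its minimal elements.\<close>
  note b = baryc_up_set[OF assms J(1,2)]
  show "ample E (up_set E J \<inter> sign_vectors E)"
    using signed_circuit_axiom_imp_ample[OF assms, of "up_set E J \<inter> sign_vectors E"]
      signed_circuit_axiom_up_set[OF J(1,2)] b by simp
  show "cocirc E (up_set E J \<inter> sign_vectors E) = J"
    unfolding cocirc_def b using min_elements_up_set[OF J(1,3)] .
qed

end
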